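(* Let $n\in\mathbb N_0$, let $\nu,\mu\in\mathbb C$ with $2\nu+1,\,2\mu+1\notin\{0,-1,-2,\ldots\}$, and let $x\in(-1,1)$. Then $${\sf P}_{n+\nu}^{-\nu}(x)=\frac{2^{\nu-\mu}\,n!\,(1-x^2)^{\frac{\nu-\mu}{2}}}{\Gamma(2\nu+n+1)}\sum_{k=0}^{\lfloor n/2\rfloor}\left(\mu+n-2k+\tfrac12\right)\frac{(\nu-\mu)_k\,\Gamma(\nu+\frac12+n-k)\,\Gamma(2\mu+n-2k+1)}{k!\,(n-2k)!\,\Gamma(\mu+\frac32+n-k)}\,{\sf P}_{n-2k+\mu}^{-\mu}(x).$$
   Context: $\mathbb N_0=\{0,1,2,\ldots\}$; $(a)_0=1$, $(a)_k=a(a+1)\cdots(a+k-1)$. The Ferrers function of the first kind is, for $\nu,\mu\in\mathbb C$ and $x\in(-1,1)$, $${\sf P}_\nu^{-\mu}(x)=\frac{1}{\Gamma(\mu+1)}\left(\frac{1-x}{1+x}\right)^{\frac{\mu}{2}}{}_2F_1\left(-\nu,\nu+1;\mu+1;\frac{1-x}{2}\right)=\left(\frac{1-x}{1+x}\right)^{\frac{\mu}{2}}\sum_{j=0}^\infty\frac{(-\nu)_j(\nu+1)_j}{\Gamma(\mu+1+j)\,j!}\left(\frac{1-x}{2}\right)^j,$$ where $1/\Gamma$ is the entire reciprocal gamma function. Powers of positive reals are principal. *)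

theory Defs
  imports "HOL-Analysis.Analysis"
begin

text \<open>
  The Ferrers function of the first kind on the cut \<open>-1 < x < 1\<close>, with
  \<open>ferrers_P \<nu> \<mu> x\<close> standing for the function of degree \<open>\<nu>\<close> and order \<open>\<mu>\<close> (upper index).
  In terms of \<open>m = -\<mu>\<close> this is
  \<open>((1-x)/(1+x))\<^sup>m\<^sup>/\<^sup>2 / \<Gamma>(m+1) \<cdot> \<^sub>2F\<^sub>1(-\<nu>, \<nu>+1; m+1; (1-x)/2)\<close>, where the prefactor is absorbed
  into the series by means of the entire function \<open>1/\<Gamma>\<close>, so that all complex \<open>\<mu>\<close> are allowed.
  The base of \<open>powr\<close> is a positive real, hence the power is the principal one.
\<close>
definition ferrers_P :: "complex \<Rightarrow> complex \<Rightarrow> real \<Rightarrow> complex" where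
  "ferrers_P \<nu> \<mu> x =
     complex_of_real ((1 - x) / (1 + x)) powr (- \<mu> / 2) *
     (\<Sum>j. pochhammer (- \<nu>) j * pochhammer (\<nu> + 1) j * rGamma (- \<mu> + 1 + of_nat j) / fact j *
           complex_of_real ((1 - x) / 2) ^ j)"

end

theory Submission
  imports Defs
begin

text \<open>
  Up to a constant and a power of \<open>1 - x\<^sup>2\<close>, \<open>P\<^bsub>n+\<nu>\<^esub>\<^bsup>-\<nu>\<^esup>(x)\<close> is the Gegenbauer polynomial \<open>C\<^sub>n\<close> of parameter
  \<open>\<nu> + 1/2\<close>, and the theorem is the classical connection formula between Gegenbauer polynomials
  of two different parameters, rewritten for Ferrers functions.

  The identification rests on the three-term recurrence in the degree. Comparing coefficients of
  the hypergeometric series shows that Ferrers functions of any complex degree and order satisfy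
  it (\<open>ferrers_P_recurrence\<close>). For degrees \<open>n + \<nu>\<close> and order \<open>-\<nu>\<close> the term with the lower degree
  drops out at \<open>n = 0\<close>, so the whole family is determined by the initial member, whose series is
  binomial (\<open>ferrers_P_diagonal\<close>). After normalisation the recurrence is that of the Gegenbauer
  polynomials, and the duplication formula simplifies the constant (\<open>ferrers_P_gegenbauer\<close>).

  The connection formula (\<open>gegenbauer_connection\<close>) is proved by the same recurrence: multiplication
  by \<open>x\<close> maps the polynomial of degree \<open>m\<close> to a combination of those of degrees \<open>m + 1\<close> and
  \<open>m - 1\<close>, so the expansion satisfies the recurrence for the other parameter as soon as its
  coefficients do, and that is a rational identity.
\<close>

section \<open>The recurrence in the degree for Ferrers functions\<close>

text \<open>
  The coefficients of \<open>\<^sub>2F\<^sub>1(-a, a+1; c; z) / \<Gamma>(c)\<close>, in the form that is entire in \<open>c\<close>.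
\<close>
definition ferrers_coeff :: "complex \<Rightarrow> complex \<Rightarrow> nat \<Rightarrow> complex" where
  "ferrers_coeff a c j =
     pochhammer (-a) j * pochhammer (a + 1) j * rGamma (c + of_nat j) / fact j"

lemma ferrers_P_eq_coeff:
  "ferrers_P a m x = complex_of_real ((1 - x) / (1 + x)) powr (- m / 2) *
     (\<Sum>j. ferrers_coeff a (1 - m) j * complex_of_real ((1 - x) / 2) ^ j)"
  by (simp add: ferrers_P_def ferrers_coeff_def add.commute)

lemma tendsto_shifted_ratio:
  fixes a b :: complex
  shows "(\<lambda>j. (of_nat j + a) / (of_nat j + b)) \<longlonglongrightarrow> 1"
proof -
  have inf: "filterlim (\<lambda>j. of_nat j + b) at_infinity sequentially"
    using tendsto_add_filterlim_at_infinity[OF tendsto_const tendsto_of_nat, of b]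
    by (simp add: add.commute)
  have "(\<lambda>j. 1 + (a - b) / (of_nat j + b)) \<longlonglongrightarrow> 1 + 0"
    by (intro tendsto_add tendsto_const tendsto_divide_0[OF tendsto_const inf])
  moreover have "eventually (\<lambda>j. 1 + (a - b) / (of_nat j + b) = (of_nat j + a) / (of_nat j + b))
                   sequentially"
    using filterlim_at_infinity_imp_eventually_ne[OF inf, of 0]
    by eventually_elim (simp add: field_simps)
  ultimately show ?thesis
    by (simp cong: filterlim_cong)
qed

lemma ferrers_coeff_Suc:
  "(of_nat j + c) * (of_nat j + 1) * ferrers_coeff a c (Suc j) =
     (of_nat j - a) * (of_nat j + (a + 1)) * ferrers_coeff a c j"
proof -
  have "rGamma (c + of_nat j) = (of_nat j + c) * rGamma (c + of_nat (Suc j))"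
    using rGamma_plus1[of "c + of_nat j"] by (simp add: ac_simps)
  moreover have "fact (Suc j) = (of_nat j + 1) * (fact j :: complex)"
    by (simp add: add.commute)
  moreover have "of_nat j + 1 \<noteq> (0 :: complex)"
    using of_nat_neq_0[of j, where ?'a = complex] by (simp add: add.commute)
  ultimately show ?thesis
    unfolding ferrers_coeff_def pochhammer_Suc
    by (simp add: divide_simps del: fact_Suc of_nat_Suc)
qed

lemma summable_ferrers_series:
  assumes "norm z < 1"
  shows "summable (\<lambda>j. ferrers_coeff a c j * z ^ j)"
proof -
  define K where "K = (1 + norm z) / 2"
  have K: "norm z < K" "K < 1" using assms by (auto simp: K_def)
  define R where
    "R = (\<lambda>j. (of_nat j + (-a)) / (of_nat j + c) * ((of_nat j + (a + 1)) / (of_nat j + 1)) * z)"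
  have "R \<longlonglongrightarrow> 1 * 1 * z"
    unfolding R_def by (intro tendsto_mult tendsto_shifted_ratio tendsto_const)
  then have "(\<lambda>j. norm (R j)) \<longlonglongrightarrow> norm z"
    using tendsto_norm by fastforce
  then have "eventually (\<lambda>j. norm (R j) < K) sequentially"
    using K(1) by (rule order_tendstoD)
  moreover have "filterlim (\<lambda>j. of_nat j + c) at_infinity sequentially"
    using tendsto_add_filterlim_at_infinity[OF tendsto_const tendsto_of_nat, of c]
    by (simp add: add.commute)
  then have "eventually (\<lambda>j. of_nat j + c \<noteq> 0) sequentially"
    by (rule filterlim_at_infinity_imp_eventually_ne)
  ultimately have "eventually (\<lambda>j. norm (ferrers_coeff a c (Suc j) * z ^ Suc j)
                     \<le> K * norm (ferrers_coeff a c j * z ^ j)) sequentially"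
  proof eventually_elim
    case (elim j)
    have "of_nat j + 1 \<noteq> (0 :: complex)"
      using of_nat_neq_0[of j, where ?'a = complex] by (simp add: add.commute)
    with elim(2) have "ferrers_coeff a c (Suc j) =
        (of_nat j - a) * (of_nat j + (a + 1)) * ferrers_coeff a c j
          / ((of_nat j + c) * (of_nat j + 1))"
      using ferrers_coeff_Suc[of j c a] by (simp add: nonzero_eq_divide_eq mult_ac)
    then have "ferrers_coeff a c (Suc j) * z ^ Suc j = R j * (ferrers_coeff a c j * z ^ j)"
      by (simp add: R_def)
    then show ?case
      using elim(1) by (simp only: norm_mult) (intro mult_right_mono; simp)
  qed
  then obtain N where "\<And>j. j \<ge> N \<Longrightarrow> norm (ferrers_coeff a c (Suc j) * z ^ Suc j)
                     \<le> K * norm (ferrers_coeff a c j * z ^ j)"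
    by (auto simp: eventually_sequentially)
  with K(2) show ?thesis by (rule summable_ratio_test)
qed

text \<open>
  This and the next lemma are the coefficients of the recurrence \<open>ferrers_P_recurrence\<close> with
  \<open>x = 1 - 2 * z\<close>, compared in powers of \<open>z\<close>.
\<close>
lemma ferrers_coeff_contiguous_0:
  "(a + c) * ferrers_coeff (a + 1) c 0 + (a + 1 - c) * ferrers_coeff (a - 1) c 0 =
     (2 * a + 1) * ferrers_coeff a c 0"
  by (simp add: ferrers_coeff_def algebra_simps)

lemma ferrers_coeff_contiguous:
  "(a + c) * ferrers_coeff (a + 1) c (Suc j) + (a + 1 - c) * ferrers_coeff (a - 1) c (Suc j) =
     (2 * a + 1) * (ferrers_coeff a c (Suc j) - 2 * ferrers_coeff a c j)"
proof (cases j)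
  case 0
  have "rGamma c = c * rGamma (c + 1)"
    by (simp add: rGamma_plus1)
  then show ?thesis
    unfolding ferrers_coeff_def 0 by (simp add: algebra_simps)
next
  case (Suc i)
  define p q r f where "p = pochhammer (1 - a) i" and "q = pochhammer (a + 2) i"
    and "r = rGamma (c + of_nat i + 2)" and "f = (fact (Suc i) :: complex)"
  \<comment> \<open>All Pochhammer symbols that occur are multiples of \<open>p\<close> or \<open>q\<close>.\<close>
  have p: "pochhammer (- (a + 1)) (Suc (Suc i)) = (- a - 1) * (- a) * p"
    "pochhammer (- a) (Suc (Suc i)) = (- a) * p * (1 - a + of_nat i)"
    "pochhammer (- (a - 1)) (Suc (Suc i)) = p * (1 - a + of_nat i) * (2 - a + of_nat i)"
    "pochhammer (- a) (Suc i) = (- a) * p"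
    using pochhammer_rec[of "- (a + 1)" "Suc i"] pochhammer_rec[of "- a" i]
      pochhammer_rec[of "- a" "Suc i"]
    by (simp_all add: p_def pochhammer_Suc[of "1 - a"] algebra_simps)
  have q: "pochhammer (a + 1 + 1) (Suc (Suc i)) = q * (a + 2 + of_nat i) * (a + 3 + of_nat i)"
    "pochhammer (a + 1) (Suc (Suc i)) = (a + 1) * q * (a + 2 + of_nat i)"
    "pochhammer (a - 1 + 1) (Suc (Suc i)) = a * (a + 1) * q"
    "pochhammer (a + 1) (Suc i) = (a + 1) * q"
    using pochhammer_rec[of "a + 1" i] pochhammer_rec[of "a + 1" "Suc i"]
      pochhammer_rec[of a "Suc i"]
    by (simp_all add: q_def pochhammer_Suc[of "a + 2"] algebra_simps)
  have r: "rGamma (c + of_nat (Suc (Suc i))) = r"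
    "rGamma (c + of_nat (Suc i)) = (c + of_nat i + 1) * r"
    unfolding r_def using rGamma_plus1[of "c + of_nat i + 1"] by (simp_all add: ac_simps)
  have f: "fact (Suc (Suc i)) = (of_nat i + 2) * f" "fact (Suc i) = f"
    by (simp_all add: f_def)
  have "f \<noteq> 0"
    unfolding f_def by (rule fact_nonzero)
  have "of_nat i + 2 \<noteq> (0 :: complex)"
    using of_nat_neq_0[of "Suc i", where ?'a = complex] by (simp add: add.commute)
  with \<open>f \<noteq> 0\<close> show ?thesis
    unfolding ferrers_coeff_def Suc p q r f by (simp add: divide_simps) algebra
qed

lemma ferrers_P_recurrence:
  assumes "-1 < x" and "x < 1"
  shows "(a - m + 1) * ferrers_P (a + 1) m x =
    (2 * a + 1) * of_real x * ferrers_P a m x - (a + m) * ferrers_P (a - 1) m x"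
proof -
  define z where "z = complex_of_real ((1 - x) / 2)"
  define c where "c = 1 - m"
  define S where "S = (\<lambda>a. \<Sum>j. ferrers_coeff a c j * z ^ j)"
  have "norm z < 1"
    using assms by (simp only: z_def norm_of_real) simp
  then have S: "(\<lambda>j. ferrers_coeff a c j * z ^ j) sums S a" for a
    unfolding S_def by (intro summable_sums summable_ferrers_series)
  have "(\<lambda>j. (a + c) * (ferrers_coeff (a + 1) c j * z ^ j)
           + (a + 1 - c) * (ferrers_coeff (a - 1) c j * z ^ j)
           - (2 * a + 1) * (ferrers_coeff a c j * z ^ j))
        sums ((a + c) * S (a + 1) + (a + 1 - c) * S (a - 1) - (2 * a + 1) * S a)"
    (is "?f sums ?s") by (intro sums_add sums_diff sums_mult S)
  moreover have "(\<lambda>j. ?f (Suc j)) sums (- 2 * (2 * a + 1) * z * S a)"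
  proof -
    have "?f (Suc j) = - 2 * (2 * a + 1) * z * (ferrers_coeff a c j * z ^ j)" for j
    proof -
      have "?f (Suc j) = ((a + c) * ferrers_coeff (a + 1) c (Suc j)
          + (a + 1 - c) * ferrers_coeff (a - 1) c (Suc j)
          - (2 * a + 1) * ferrers_coeff a c (Suc j)) * z ^ Suc j"
        by (simp add: algebra_simps)
      also have "\<dots> = - 2 * (2 * a + 1) * z * (ferrers_coeff a c j * z ^ j)"
        by (simp only: ferrers_coeff_contiguous) (simp add: algebra_simps)
      finally show ?thesis .
    qed
    then show ?thesis using sums_mult[OF S] by presburger
  qed
  moreover have "?f 0 = 0"
    using ferrers_coeff_contiguous_0[of a c] by simp
  ultimately have "?s = - 2 * (2 * a + 1) * z * S a"
    using sums_Suc[of ?f] sums_unique2 by fastforce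
  moreover have "of_real x = 1 - 2 * z"
    by (simp add: z_def field_simps)
  ultimately have rec: "(a + c) * S (a + 1) = (2 * a + 1) * of_real x * S a - (a + 1 - c) * S (a - 1)"
    by algebra
  have P: "ferrers_P a m x = complex_of_real ((1 - x) / (1 + x)) powr (- m / 2) * S a" for a
    by (simp add: ferrers_P_eq_coeff S_def c_def z_def)
  show ?thesis
    unfolding P using rec[unfolded c_def] by algebra
qed

lemma ferrers_P_diagonal:
  assumes "-1 < x" and "x < 1"
  shows "ferrers_P \<nu> (- \<nu>) x =
    2 powr (- \<nu>) * complex_of_real (1 - x\<^sup>2) powr (\<nu> / 2) * rGamma (\<nu> + 1)"
proof -
  define z where "z = complex_of_real ((1 - x) / 2)"
  have "norm z < 1"
    using assms by (simp only: z_def norm_of_real) simp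
  then have "(\<lambda>j. rGamma (\<nu> + 1) * ((\<nu> gchoose j) * (-z) ^ j)) sums
               (rGamma (\<nu> + 1) * (1 + (-z)) powr \<nu>)"
    by (intro sums_mult gen_binomial_complex) simp
  moreover have "rGamma (\<nu> + 1) * ((\<nu> gchoose j) * (-z) ^ j) =
      ferrers_coeff \<nu> (1 - (-\<nu>)) j * z ^ j" for j
  proof -
    have "(- z) ^ j = (-1) ^ j * z ^ j"
      by (rule power_minus)
    then show ?thesis
      using pochhammer_rGamma[of "\<nu> + 1" j]
      by (simp add: ferrers_coeff_def gbinomial_pochhammer ac_simps flip: power_add)
  qed
  ultimately have "(\<Sum>j. ferrers_coeff \<nu> (1 - (-\<nu>)) j * z ^ j) =
      rGamma (\<nu> + 1) * (1 - z) powr \<nu>"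
    by (simp add: sums_iff)
  moreover have "1 - z = complex_of_real ((1 + x) / 2)"
    by (simp add: z_def field_simps)
  ultimately have eq: "ferrers_P \<nu> (- \<nu>) x = complex_of_real ((1 - x) / (1 + x)) powr (\<nu> / 2) *
      complex_of_real ((1 + x) / 2) powr \<nu> * rGamma (\<nu> + 1)"
    by (simp only: ferrers_P_eq_coeff z_def[symmetric] minus_minus mult_ac)
  have powr: "complex_of_real r powr s = exp (s * of_real (ln r))" if "r > 0" for r s
    using that by (simp add: powr_def Ln_of_real)
  have sq: "1 - x\<^sup>2 = (1 - x) * (1 + x)"
    by (simp add: power2_eq_square algebra_simps)
  have pos: "(1 - x) / (1 + x) > 0" "(1 + x) / 2 > 0" "1 - x\<^sup>2 > 0" "(2 :: real) > 0"
    using assms unfolding sq by simp_all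
  have ln: "ln ((1 - x) / (1 + x)) = ln (1 - x) - ln (1 + x)"
    "ln ((1 + x) / 2) = ln (1 + x) - ln 2" "ln (1 - x\<^sup>2) = ln (1 - x) + ln (1 + x)"
    using assms by (simp_all add: sq ln_div ln_mult)
  have "complex_of_real ((1 - x) / (1 + x)) powr (\<nu> / 2) * complex_of_real ((1 + x) / 2) powr \<nu> =
      complex_of_real 2 powr (- \<nu>) * complex_of_real (1 - x\<^sup>2) powr (\<nu> / 2)"
    unfolding powr[OF pos(1)] powr[OF pos(2)] powr[OF pos(3)] powr[OF pos(4)] ln exp_add[symmetric]
    by (simp add: field_simps)
  then show ?thesis by (simp add: eq)
qed

section \<open>Gegenbauer polynomials\<close>

text \<open>
  The Gegenbauer polynomial of parameter \<open>l\<close> and degree \<open>n\<close>, defined by its recurrence, which is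
  meaningful for every complex \<open>l\<close>.
\<close>
fun gegenbauer :: "complex \<Rightarrow> nat \<Rightarrow> complex \<Rightarrow> complex" where
  "gegenbauer l 0 x = 1"
| "gegenbauer l (Suc 0) x = 2 * l * x"
| "gegenbauer l (Suc (Suc n)) x =
     (2 * (of_nat n + 1 + l) * x * gegenbauer l (Suc n) x - (of_nat n + 2 * l) * gegenbauer l n x)
       / (of_nat n + 2)"

lemma gegenbauer_recurrence:
  "(of_nat n + 2) * gegenbauer l (Suc (Suc n)) x =
     2 * (of_nat n + 1 + l) * x * gegenbauer l (Suc n) x - (of_nat n + 2 * l) * gegenbauer l n x"
proof -
  have "of_nat n + 2 \<noteq> (0 :: complex)"
    using of_nat_neq_0[of "Suc n", where ?'a = complex] by (simp add: add.commute)
  then show ?thesis by simp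
qed

text \<open>The recurrence for all degrees, where the polynomial of degree \<open>-1\<close> is taken to be zero.\<close>
lemma gegenbauer_mult_x:
  "2 * (of_nat m + l) * x * gegenbauer l m x =
     (of_nat m + 1) * gegenbauer l (Suc m) x
     + (if m = 0 then 0 else (of_nat m - 1 + 2 * l) * gegenbauer l (m - 1) x)"
proof (cases m)
  case (Suc n)
  then show ?thesis
    using gegenbauer_recurrence[of n l x]
    by (simp add: algebra_simps del: gegenbauer.simps(3))
qed simp

text \<open>
  The coefficient of the polynomial of degree \<open>m\<close> and parameter \<open>l'\<close> in the expansion of the
  polynomial of degree \<open>2 * k + m\<close> and parameter \<open>l\<close>.
\<close>
definition connection_coeff :: "complex \<Rightarrow> complex \<Rightarrow> nat \<Rightarrow> nat \<Rightarrow> complex" where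
  "connection_coeff l l' k m =
     (l' + of_nat m) * pochhammer (l - l') k * pochhammer l (k + m)
       / (fact k * pochhammer l' (Suc (k + m)))"

context
  fixes l l' :: complex
  assumes l': "l' \<notin> \<int>\<^sub>\<le>\<^sub>0"
begin

private lemma shift_nonzero: "l' + of_nat j \<noteq> 0"
  using l' by (metis add.commute add_eq_0_iff minus_of_nat_in_nonpos_Ints add.inverse_inverse)

private lemma pochhammer_nonzero: "pochhammer l' j \<noteq> 0"
  using l' by (auto simp: pochhammer_eq_0_iff)

lemma connection_coeff_rec_0:
  "(of_nat m + 2) * connection_coeff l l' 0 (Suc (Suc m)) =
     (of_nat m + 1 + l) * (of_nat m + 2) / (l' + of_nat (Suc m)) * connection_coeff l l' 0 (Suc m)"
proof -
  have c: "connection_coeff l l' 0 (Suc j) = pochhammer l (Suc j) / pochhammer l' (Suc j)" for j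
    using shift_nonzero[of "Suc j"] pochhammer_nonzero[of "Suc j"]
    unfolding connection_coeff_def by (simp add: pochhammer_Suc[of l' "Suc j"])
  then show ?thesis
    using shift_nonzero[of "Suc m"] pochhammer_nonzero[of "Suc m"]
    unfolding c pochhammer_Suc[of _ "Suc m"]
    by (simp add: divide_simps)
qed

text \<open>
  Together with the previous lemma, this says that the expansion satisfies the recurrence for the
  parameter \<open>l\<close> in its coefficient at degree \<open>m\<close>. Multiplication by \<open>x\<close> reaches this degree from
  \<open>m - 1\<close>, unless \<open>m = 0\<close>, and from \<open>m + 1\<close>.
\<close>
lemma connection_coeff_rec:
  fixes k m :: nat
  defines "n \<equiv> 2 * of_nat k + of_nat m"
  shows "(n + 2) * connection_coeff l l' (Suc k) m =
     (n + 1 + l) *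
       ((if m = 0 then 0 else of_nat m / (l' + of_nat (m - 1)) * connection_coeff l l' (Suc k) (m - 1))
        + (of_nat m + 2 * l') / (l' + of_nat (Suc m)) * connection_coeff l l' k (Suc m))
     - (n + 2 * l) * connection_coeff l l' k m"
proof -
  define p q r f where "p = pochhammer (l - l') k" and "q = pochhammer l (k + m)"
    and "r = pochhammer l' (Suc (k + m))" and "f = (fact k :: complex)"
  define s where "s = l' + of_nat k + of_nat m + 1"
  have nz: "r \<noteq> 0" "f \<noteq> 0" "s \<noteq> 0"
    using shift_nonzero[of "Suc (k + m)"]
    by (auto simp: r_def f_def s_def pochhammer_nonzero ac_simps)
  have k: "of_nat k + 1 \<noteq> (0 :: complex)"
    using of_nat_neq_0[of k, where ?'a = complex] by (simp add: add.commute)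
  have 1: "connection_coeff l l' (Suc k) m =
      (l' + of_nat m) * (p * (l - l' + of_nat k)) * (q * (l + of_nat k + of_nat m))
        / ((of_nat k + 1) * f * (r * s))"
    by (simp add: connection_coeff_def p_def q_def r_def f_def s_def
        pochhammer_Suc[of l' "Suc (k + m)"] pochhammer_Suc[of l] pochhammer_Suc[of "l - l'"] ac_simps)
  have 2: "(if m = 0 then 0
       else of_nat m / (l' + of_nat (m - 1)) * connection_coeff l l' (Suc k) (m - 1)) =
      of_nat m * (p * (l - l' + of_nat k)) * q / ((of_nat k + 1) * f * r)"
  proof (cases m)
    case (Suc i)
    then show ?thesis
      using shift_nonzero[of i]
      by (simp add: connection_coeff_def p_def q_def r_def f_def
          pochhammer_Suc[of "l - l'"] ac_simps)
  qed simp
  have 3: "(of_nat m + 2 * l') / (l' + of_nat (Suc m)) * connection_coeff l l' k (Suc m) =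
      (of_nat m + 2 * l') * p * (q * (l + of_nat k + of_nat m)) / (f * (r * s))"
    using shift_nonzero[of "Suc m"]
    by (simp add: connection_coeff_def p_def q_def r_def f_def s_def
        pochhammer_Suc[of l' "Suc (k + m)"] pochhammer_Suc[of l] ac_simps)
  have 4: "connection_coeff l l' k m = (l' + of_nat m) * p * q / (f * r)"
    by (simp add: connection_coeff_def p_def q_def r_def f_def)
  show ?thesis
    unfolding 1 2 3 4 using nz k
    by (simp add: divide_simps) (simp add: n_def s_def; algebra)
qed

theorem gegenbauer_connection:
  "gegenbauer l n x =
     (\<Sum>k = 0..n div 2. connection_coeff l l' k (n - 2 * k) * gegenbauer l' (n - 2 * k) x)"
proof -
  \<comment> \<open>Extending the summands by zero makes the upper limit of summation irrelevant.\<close>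
  define b where "b = (\<lambda>n k. if 2 * k \<le> n
    then connection_coeff l l' k (n - 2 * k) * gegenbauer l' (n - 2 * k) x else 0)"
  define S where "S = (\<lambda>n. \<Sum>k\<le>n. b n k)"
  have S: "S n = (\<Sum>k\<le>N. b n k)" if "n \<le> N" for n N
    unfolding S_def using that by (intro sum.mono_neutral_left) (auto simp: b_def)
  have S_rec: "(of_nat n + 2) * S (Suc (Suc n)) =
      2 * (of_nat n + 1 + l) * x * S (Suc n) - (of_nat n + 2 * l) * S n" for n
  proof -
    \<comment> \<open>The contributions of \<open>2 * x * b (Suc n) k\<close> to the polynomials of degrees one higher and one
      lower than that of \<open>b (Suc n) k\<close>.\<close>
    define u v where
      "u = (\<lambda>k. if 2 * k \<le> Suc n then let m = Suc n - 2 * k in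
         connection_coeff l l' k m * (of_nat m + 1) / (l' + of_nat m) * gegenbauer l' (Suc m) x
         else 0)" and
      "v = (\<lambda>k. if 2 * k \<le> n then let m = n - 2 * k in
         connection_coeff l l' k (Suc m) * (of_nat m + 2 * l') / (l' + of_nat (Suc m))
           * gegenbauer l' m x
         else 0)"
    have split: "2 * x * b (Suc n) k = u k + v k" for k
    proof (cases "2 * k \<le> Suc n")
      case True
      define m where "m = Suc n - 2 * k"
      have "2 * x * gegenbauer l' m x = (of_nat m + 1) / (l' + of_nat m) * gegenbauer l' (Suc m) x
          + (if m = 0 then 0
             else (of_nat m - 1 + 2 * l') / (l' + of_nat m) * gegenbauer l' (m - 1) x)"
      proof -
        have "2 * x * gegenbauer l' m x = ((of_nat m + 1) * gegenbauer l' (Suc m) x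
            + (if m = 0 then 0 else (of_nat m - 1 + 2 * l') * gegenbauer l' (m - 1) x))
              / (l' + of_nat m)"
          unfolding gegenbauer_mult_x[symmetric] using shift_nonzero[of m]
          by (simp add: nonzero_eq_divide_eq ac_simps)
        then show ?thesis
          by (cases "m = 0")
             (simp_all add: add_divide_distrib[of "(of_nat m + 1) * gegenbauer l' (Suc m) x"]
                       del: gegenbauer.simps)
      qed
      moreover have "u k = connection_coeff l l' k m *
          ((of_nat m + 1) / (l' + of_nat m) * gegenbauer l' (Suc m) x)"
        using True by (simp add: u_def m_def Let_def)
      moreover have "v k = connection_coeff l l' k m * (if m = 0 then 0
             else (of_nat m - 1 + 2 * l') / (l' + of_nat m) * gegenbauer l' (m - 1) x)"
      proof (cases m)
        case 0
        then have "\<not> 2 * k \<le> n" using True by (simp add: m_def)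
        then show ?thesis using 0 by (simp add: v_def)
      next
        case (Suc i)
        then have "n - 2 * k = i" "2 * k \<le> n" by (auto simp: m_def)
        then show ?thesis using Suc by (simp add: v_def)
      qed
      moreover have "b (Suc n) k = connection_coeff l l' k m * gegenbauer l' m x"
        using True by (simp add: b_def m_def)
      ultimately show ?thesis by algebra
    qed (simp add: b_def u_def v_def)
    have step_0: "(of_nat n + 2) * b (Suc (Suc n)) 0 = (of_nat n + 1 + l) * u 0"
    proof -
      have "(of_nat n + 1 + l) * u 0 = (of_nat n + 1 + l) * (of_nat n + 2) / (l' + of_nat (Suc n))
          * connection_coeff l l' 0 (Suc n) * gegenbauer l' (Suc (Suc n)) x"
        by (simp add: u_def Let_def ac_simps del: gegenbauer.simps)
      then show ?thesis
        unfolding connection_coeff_rec_0[symmetric] by (simp add: b_def del: gegenbauer.simps)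
    qed
    have step: "(of_nat n + 2) * b (Suc (Suc n)) (Suc k) =
        (of_nat n + 1 + l) * (u (Suc k) + v k) - (of_nat n + 2 * l) * b n k" for k
    proof (cases "2 * k \<le> n")
      case True
      define m where "m = n - 2 * k"
      define g where "g = gegenbauer l' m x"
      have n: "n = 2 * k + m" using True by (simp add: m_def)
      have bv: "b (Suc (Suc n)) (Suc k) = connection_coeff l l' (Suc k) m * g"
        "b n k = connection_coeff l l' k m * g"
        "v k = (of_nat m + 2 * l') / (l' + of_nat (Suc m)) * connection_coeff l l' k (Suc m) * g"
        by (simp_all add: b_def v_def n g_def del: of_nat_Suc)
      have "u (Suc k) = (if m = 0 then 0 else of_nat m / (l' + of_nat (m - 1))
          * connection_coeff l l' (Suc k) (m - 1)) * g"
        by (cases m) (simp_all add: u_def n g_def Let_def ac_simps del: gegenbauer.simps)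
      with bv show ?thesis
        using connection_coeff_rec[of k m] unfolding n of_nat_add of_nat_mult of_nat_numeral
        by algebra
    qed (simp add: b_def u_def v_def)
    define N where "N = Suc n"
    have "v N = 0" "b n N = 0" by (simp_all add: v_def b_def N_def)
    have "(of_nat n + 2) * S (Suc (Suc n)) = (\<Sum>k\<le>Suc N. (of_nat n + 2) * b (Suc (Suc n)) k)"
      by (simp only: S_def N_def sum_distrib_left)
    also have "\<dots> = (of_nat n + 1 + l) * u 0 + (\<Sum>k\<le>N. (of_nat n + 1 + l) * (u (Suc k) + v k)
                  - (of_nat n + 2 * l) * b n k)"
      by (simp only: sum.atMost_Suc_shift step_0 step)
    also have "\<dots> = (of_nat n + 1 + l) * ((u 0 + (\<Sum>k\<le>N. u (Suc k))) + (\<Sum>k\<le>N. v k))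
                  - (of_nat n + 2 * l) * (\<Sum>k\<le>N. b n k)"
      by (simp add: sum.distrib sum_subtractf algebra_simps sum_distrib_left)
    also have "u 0 + (\<Sum>k\<le>N. u (Suc k)) = (\<Sum>k\<le>N. u k)"
      unfolding sum.atMost_Suc_shift[symmetric] by (simp add: u_def N_def)
    also have "(\<Sum>k\<le>N. u k) + (\<Sum>k\<le>N. v k) = 2 * x * S (Suc n)"
      by (simp only: S_def N_def[symmetric] split[folded N_def] sum_distrib_left sum.distrib)
    also have "(\<Sum>k\<le>N. b n k) = S n"
      by (rule S[symmetric]) (simp add: N_def)
    finally show ?thesis by (simp add: ac_simps)
  qed
  have "gegenbauer l n x = S n"
  proof (induction n rule: induct_nat_012)
    case 0
    show ?case
      using shift_nonzero[of 0] by (simp add: S_def b_def connection_coeff_def)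
  next
    case 1
    show ?case
      using shift_nonzero[of 0] shift_nonzero[of 1]
      by (simp add: S_def b_def connection_coeff_def pochhammer_Suc)
  next
    case (ge2 n)
    have "(of_nat n + 2) * gegenbauer l (Suc (Suc n)) x = (of_nat n + 2) * S (Suc (Suc n))"
      unfolding gegenbauer_recurrence S_rec ge2 ..
    moreover have "of_nat n + 2 \<noteq> (0 :: complex)"
      using of_nat_neq_0[of "Suc n", where ?'a = complex] by (simp add: add.commute)
    ultimately show ?case by simp
  qed
  also have "S n = (\<Sum>k = 0..n div 2. b n k)"
    unfolding S_def by (intro sum.mono_neutral_right) (auto simp: b_def)
  also have "\<dots> = (\<Sum>k = 0..n div 2.
      connection_coeff l l' k (n - 2 * k) * gegenbauer l' (n - 2 * k) x)"
    by (intro sum.cong) (auto simp: b_def)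
  finally show ?thesis .
qed

end

section \<open>Ferrers functions as Gegenbauer polynomials\<close>

lemma plus_of_nat_notin_nonpos_Ints:
  fixes z :: complex
  assumes "z \<notin> \<int>\<^sub>\<le>\<^sub>0"
  shows "z + of_nat n \<notin> \<int>\<^sub>\<le>\<^sub>0"
proof
  assume "z + of_nat n \<in> \<int>\<^sub>\<le>\<^sub>0"
  then obtain k where "z + of_nat n = - of_nat k" by (elim nonpos_Ints_cases')
  then have "z = - of_nat (k + n)" by (simp add: algebra_simps eq_neg_iff_add_eq_0)
  with assms show False by (metis minus_of_nat_in_nonpos_Ints)
qed

lemma half_shifts_notin_nonpos_Ints:
  fixes \<nu> :: complex
  assumes "2 * \<nu> + 1 \<notin> \<int>\<^sub>\<le>\<^sub>0"
  shows "\<nu> + 1 / 2 \<notin> \<int>\<^sub>\<le>\<^sub>0" and "\<nu> + 1 \<notin> \<int>\<^sub>\<le>\<^sub>0"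
proof -
  show "\<nu> + 1 / 2 \<notin> \<int>\<^sub>\<le>\<^sub>0"
  proof
    assume "\<nu> + 1 / 2 \<in> \<int>\<^sub>\<le>\<^sub>0"
    then obtain n where "\<nu> + 1 / 2 = - of_nat n" by (elim nonpos_Ints_cases')
    then have "2 * \<nu> + 1 = - of_nat (2 * n)" by (simp add: field_simps)
    with assms show False by (metis minus_of_nat_in_nonpos_Ints)
  qed
  show "\<nu> + 1 \<notin> \<int>\<^sub>\<le>\<^sub>0"
  proof
    assume "\<nu> + 1 \<in> \<int>\<^sub>\<le>\<^sub>0"
    then obtain n where "\<nu> + 1 = - of_nat n" by (elim nonpos_Ints_cases')
    then have "\<nu> = - of_nat n - 1" by (simp add: eq_diff_eq)
    then have "2 * \<nu> + 1 = - of_nat (2 * n + 1)" by simp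
    with assms show False by (metis minus_of_nat_in_nonpos_Ints)
  qed
qed

lemma ferrers_P_gegenbauer:
  assumes "2 * \<nu> + 1 \<notin> \<int>\<^sub>\<le>\<^sub>0" and x: "-1 < x" "x < 1"
  shows "ferrers_P (of_nat n + \<nu>) (- \<nu>) x =
    2 powr \<nu> / of_real (sqrt pi) * complex_of_real (1 - x\<^sup>2) powr (\<nu> / 2) * Gamma (\<nu> + 1 / 2)
      * fact n / Gamma (2 * \<nu> + of_nat n + 1) * gegenbauer (\<nu> + 1 / 2) n (of_real x)"
proof -
  note nonpos = half_shifts_notin_nonpos_Ints[OF assms(1)]
  define B where "B = 2 powr \<nu> / of_real (sqrt pi) * complex_of_real (1 - x\<^sup>2) powr (\<nu> / 2)
    * Gamma (\<nu> + 1 / 2)"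
  define P where "P = (\<lambda>n. ferrers_P (of_nat n + \<nu>) (- \<nu>) x)"
  define C where "C = (\<lambda>n. gegenbauer (\<nu> + 1 / 2) n (of_real x))"
  define G where "G = (\<lambda>n. Gamma (2 * \<nu> + of_nat n + 1))"
  have nz: "2 * \<nu> + of_nat n + 1 \<notin> \<int>\<^sub>\<le>\<^sub>0" for n
    using plus_of_nat_notin_nonpos_Ints[OF assms(1), of n] by (simp add: ac_simps)
  then have G_nz: "G n \<noteq> 0" and nz': "2 * \<nu> + of_nat n + 1 \<noteq> 0" for n
    by (auto simp: G_def Gamma_eq_zero_iff) (metis nz zero_in_nonpos_Ints)
  have G_Suc: "G (Suc n) = (2 * \<nu> + of_nat n + 1) * G n" for n
    using Gamma_plus1[OF nz[of n]] by (simp add: G_def ac_simps)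
  have rec: "(of_nat n + 2 * \<nu> + 1) * P (Suc n) =
      (2 * of_nat n + 2 * \<nu> + 1) * of_real x * P n
        - of_nat n * ferrers_P (of_nat n + \<nu> - 1) (- \<nu>) x" for n
    using ferrers_P_recurrence[OF x, of "of_nat n + \<nu>" "-\<nu>"]
    by (simp add: P_def algebra_simps)
  have P0: "P 0 * G 0 = B"
  proof -
    have "2 * \<nu> + 1 = 2 * (\<nu> + 1 / 2)" and half: "\<nu> + 1 / 2 + 1 / 2 = \<nu> + 1" by simp_all
    moreover have "exp ((1 - 2 * (\<nu> + 1 / 2)) * of_real (ln 2)) = 2 powr (- 2 * \<nu>)"
      by (simp add: powr_def Ln_of_real[of 2, simplified] algebra_simps)
    ultimately have "Gamma (\<nu> + 1 / 2) * Gamma (\<nu> + 1) =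
        2 powr (- 2 * \<nu>) * of_real (sqrt pi) * G 0"
      using Gamma_legendre_duplication[of "\<nu> + 1 / 2", unfolded half] nonpos by (simp add: G_def)
    moreover have "2 powr (- 2 * \<nu>) * 2 powr \<nu> = (2 powr (- \<nu>) :: complex)"
      by (simp flip: powr_add)
    moreover have "P 0 * Gamma (\<nu> + 1) = 2 powr (- \<nu>) * complex_of_real (1 - x\<^sup>2) powr (\<nu> / 2)"
      using ferrers_P_diagonal[OF x, of \<nu>] nonpos(2)
      by (simp add: P_def rGamma_inverse_Gamma Gamma_eq_zero_iff)
    moreover have "B * of_real (sqrt pi) =
        2 powr \<nu> * complex_of_real (1 - x\<^sup>2) powr (\<nu> / 2) * Gamma (\<nu> + 1 / 2)"
      by (simp add: B_def)
    ultimately have "(P 0 * G 0) * (of_real (sqrt pi) * Gamma (\<nu> + 1)) =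
        B * (of_real (sqrt pi) * Gamma (\<nu> + 1))"
      by algebra
    moreover have "Gamma (\<nu> + 1) \<noteq> 0"
      using nonpos(2) by (simp add: Gamma_eq_zero_iff)
    ultimately show ?thesis by simp
  qed
  have "P n * G n = B * fact n * C n"
  proof (induction n rule: induct_nat_012)
    case 0
    show ?case using P0 by (simp add: C_def)
  next
    case 1
    have "P 1 * G 1 = (2 * \<nu> + 1) * of_real x * (P 0 * G 0)"
      using rec[of 0] G_Suc[of 0] by simp algebra
    then show ?case
      unfolding P0 by (simp add: C_def algebra_simps)
  next
    case (ge2 n)
    have "of_nat (Suc n) + \<nu> - 1 = of_nat n + \<nu>" by simp
    then have "(of_nat n + 2 * \<nu> + 2) * P (Suc (Suc n)) =
        (2 * of_nat n + 2 * \<nu> + 3) * of_real x * P (Suc n) - (of_nat n + 1) * P n"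
      using rec[of "Suc n"] by (simp add: P_def algebra_simps)
    moreover have "G (Suc (Suc n)) = (of_nat n + 2 * \<nu> + 2) * G (Suc n)"
      using G_Suc[of "Suc n"] by (simp add: algebra_simps)
    ultimately have "P (Suc (Suc n)) * G (Suc (Suc n)) =
        (2 * of_nat n + 2 * \<nu> + 3) * of_real x * (P (Suc n) * G (Suc n))
        - (of_nat n + 1) * (2 * \<nu> + of_nat n + 1) * (P n * G n)"
      using G_Suc[of n] by algebra
    also have "\<dots> = B * fact (Suc n) * ((2 * of_nat n + 2 * \<nu> + 3) * of_real x * C (Suc n)
        - (2 * \<nu> + of_nat n + 1) * C n)"
      unfolding ge2 by (simp add: algebra_simps)
    also have "(2 * of_nat n + 2 * \<nu> + 3) * of_real x * C (Suc n)
        - (2 * \<nu> + of_nat n + 1) * C n = (of_nat n + 2) * C (Suc (Suc n))"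
      unfolding C_def gegenbauer_recurrence by (simp add: algebra_simps)
    finally show ?case
      by (simp add: algebra_simps)
  qed
  then have "P n = B * fact n / G n * C n"
    using G_nz[of n] by (simp add: field_simps)
  then show ?thesis
    by (simp add: P_def B_def G_def C_def)
qed

section \<open>The connection formula for Ferrers functions\<close>

theorem corollary3p1:
  fixes n :: nat and \<nu> \<mu> :: complex and x :: real
  assumes "2 * \<nu> + 1 \<notin> \<int>\<^sub>\<le>\<^sub>0" and "2 * \<mu> + 1 \<notin> \<int>\<^sub>\<le>\<^sub>0"
    and "-1 < x" and "x < 1"
  shows "ferrers_P (of_nat n + \<nu>) (- \<nu>) x =
    2 powr (\<nu> - \<mu>) * fact n * complex_of_real (1 - x\<^sup>2) powr ((\<nu> - \<mu>) / 2)
      / Gamma (2 * \<nu> + of_nat n + 1) *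
    (\<Sum>k = 0..n div 2.
       (\<mu> + of_nat n - 2 * of_nat k + 1 / 2) *
       (pochhammer (\<nu> - \<mu>) k * Gamma (\<nu> + 1 / 2 + of_nat n - of_nat k)
          * Gamma (2 * \<mu> + of_nat n - 2 * of_nat k + 1)
        / (fact k * fact (n - 2 * k) * Gamma (\<mu> + 3 / 2 + of_nat n - of_nat k))) *
       ferrers_P (of_nat n - 2 * of_nat k + \<mu>) (- \<mu>) x)"
proof -
  define l l' where "l = \<nu> + 1 / 2" and "l' = \<mu> + 1 / 2"
  have l: "l \<notin> \<int>\<^sub>\<le>\<^sub>0" and l': "l' \<notin> \<int>\<^sub>\<le>\<^sub>0"
    using assms half_shifts_notin_nonpos_Ints by (auto simp: l_def l'_def)
  define D where
    "D = 2 powr \<mu> / of_real (sqrt pi) * complex_of_real (1 - x\<^sup>2) powr (\<mu> / 2)"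
  have summand: "(\<mu> + of_nat n - 2 * of_nat k + 1 / 2) *
       (pochhammer (\<nu> - \<mu>) k * Gamma (\<nu> + 1 / 2 + of_nat n - of_nat k)
          * Gamma (2 * \<mu> + of_nat n - 2 * of_nat k + 1)
        / (fact k * fact (n - 2 * k) * Gamma (\<mu> + 3 / 2 + of_nat n - of_nat k))) *
       ferrers_P (of_nat n - 2 * of_nat k + \<mu>) (- \<mu>) x =
     D * Gamma l * (connection_coeff l l' k (n - 2 * k) * gegenbauer l' (n - 2 * k) (of_real x))"
    if "k \<in> {0..n div 2}" for k
  proof -
    define m where "m = n - 2 * k"
    have n: "n = 2 * k + m" using that by (auto simp: m_def)
    have "2 * \<mu> + of_nat m + 1 \<notin> \<int>\<^sub>\<le>\<^sub>0"
      using plus_of_nat_notin_nonpos_Ints[OF assms(2), of m] by (simp add: ac_simps)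
    then have nz: "Gamma (2 * \<mu> + of_nat m + 1) \<noteq> 0" "Gamma l' \<noteq> 0"
      using l' by (simp_all add: Gamma_eq_zero_iff)
    have G: "Gamma (\<nu> + 1 / 2 + of_nat n - of_nat k) = Gamma l * pochhammer l (k + m)"
      "Gamma (\<mu> + 3 / 2 + of_nat n - of_nat k) = Gamma l' * pochhammer l' (Suc (k + m))"
      using pochhammer_Gamma[OF l, of "k + m"] pochhammer_Gamma[OF l', of "Suc (k + m)"] l nz
      by (simp_all add: n l_def l'_def Gamma_eq_zero_iff algebra_simps)
    have s: "\<mu> + of_nat n - 2 * of_nat k + 1 / 2 = l' + of_nat m" "\<nu> - \<mu> = l - l'"
      "2 * \<mu> + of_nat n - 2 * of_nat k + 1 = 2 * \<mu> + of_nat m + 1"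
      "of_nat n - 2 * of_nat k + \<mu> = of_nat m + \<mu>"
      by (simp_all add: n l_def l'_def)
    show ?thesis
      unfolding G s m_def[symmetric] ferrers_P_gegenbauer[OF assms(2-4)]
      unfolding D_def[symmetric] l'_def[symmetric] connection_coeff_def
      using nz by (simp add: divide_simps)
  qed
  have "2 powr \<nu> = 2 powr (\<nu> - \<mu>) * (2 powr \<mu> :: complex)"
    by (simp flip: powr_add)
  moreover have "complex_of_real (1 - x\<^sup>2) powr (\<nu> / 2) =
      complex_of_real (1 - x\<^sup>2) powr ((\<nu> - \<mu>) / 2) * complex_of_real (1 - x\<^sup>2) powr (\<mu> / 2)"
    by (simp add: diff_divide_distrib flip: powr_add)
  ultimately have "2 powr \<nu> / of_real (sqrt pi) * complex_of_real (1 - x\<^sup>2) powr (\<nu> / 2) =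
      2 powr (\<nu> - \<mu>) * complex_of_real (1 - x\<^sup>2) powr ((\<nu> - \<mu>) / 2) * D"
    by (simp add: D_def)
  then have "ferrers_P (of_nat n + \<nu>) (- \<nu>) x =
      2 powr (\<nu> - \<mu>) * fact n * complex_of_real (1 - x\<^sup>2) powr ((\<nu> - \<mu>) / 2)
        / Gamma (2 * \<nu> + of_nat n + 1) * (D * Gamma l * gegenbauer l n (of_real x))"
    unfolding ferrers_P_gegenbauer[OF assms(1,3,4)] by (simp add: l_def)
  also have "D * Gamma l * gegenbauer l n (of_real x) = (\<Sum>k = 0..n div 2. D * Gamma l *
      (connection_coeff l l' k (n - 2 * k) * gegenbauer l' (n - 2 * k) (of_real x)))"
    unfolding gegenbauer_connection[OF l', of l n] by (rule sum_distrib_left)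
  finally show ?thesis
    by (simp only: summand cong: sum.cong)
qed

end
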